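(* Let $T = \{n \in \mathbb{N}:v_2(n) \in A^*_3\}$. Then among all sets $S\subset\mathbb{N}$ which contain no three-term $2$-geometric progression and have a $2$-graded density, $T$ has the largest asymptotic density. Moreover $d(T) < 0.845398 < \overline{\alpha_2}$.
   Context: $v_2(n)$ is the $2$-adic valuation of $n$. $A^*_3$ is the set of nonnegative integers whose base-$3$ expansion contains no digit $2$ (equivalently, the set $\{0,1,3,4,9,10,\dots\}$ obtained by greedily choosing nonnegative integers avoiding three-term arithmetic progressions). A three-term $2$-geometric progression is a triple $(a, ak, ak^2)$ of positive integers with $k=2^m$ for some integer $m\ge1$ (i.e. a rational-ratio geometric progression whose ratio involves only the prime $2$). A set $S\subset\mathbb{N}$ has a $2$-graded density if for every $i\ge0$ the set $S_i=\{s\in S: v_2(s)=i\}$ has an asymptotic density. $d$ denotes asymptotic density. $\overline{\alpha_2}=\lim_{N\to\infty}g_2(N)/N$, where $g_2(N)$ is the largest size of a subset of $\{1,\dots,N\}$ containing no three-term $2$-geometric progression; equivalently, $\overline{\alpha_2}$ is the supremum of upper densities of subsets of $\mathbb{N}$ containing no three-term $2$-geometric progression. *)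

theory Defs
  imports Complex_Main "HOL-Computational_Algebra.Primes"
begin

definition density_seq :: "nat set \<Rightarrow> nat \<Rightarrow> real" where
  "density_seq S N = real (card (S \<inter> {1..N})) / real N"

definition has_asymptotic_density :: "nat set \<Rightarrow> bool" where
  "has_asymptotic_density S \<longleftrightarrow> convergent (density_seq S)"

text \<open>Only meaningful for sets with \<^const>\<open>has_asymptotic_density\<close>.\<close>
definition asymptotic_density :: "nat set \<Rightarrow> real" where
  "asymptotic_density S = lim (density_seq S)"

definition two_GP_free :: "nat set \<Rightarrow> bool" where
  "two_GP_free S \<longleftrightarrow>
     \<not> (\<exists>a k m. a > 0 \<and> m \<ge> 1 \<and> k = 2 ^ m \<and> a \<in> S \<and> a * k \<in> S \<and> a * k ^ 2 \<in> S)"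

definition two_graded_density :: "nat set \<Rightarrow> bool" where
  "two_graded_density S \<longleftrightarrow>
     (\<forall>i. has_asymptotic_density {s \<in> S. multiplicity 2 s = i})"

text \<open>\<open>n div 3 ^ j mod 3\<close> is the digit of \<open>n\<close> at \<open>3 ^ j\<close> in base 3.\<close>
definition A3_star :: "nat set" where
  "A3_star = {n. \<forall>j. n div 3 ^ j mod 3 \<noteq> 2}"

text \<open>Zero is excluded explicitly, since the library sets \<open>multiplicity 2 0 = 0\<close>.\<close>
definition T_set :: "nat set" where
  "T_set = {n. n > 0 \<and> multiplicity 2 n \<in> A3_star}"

definition g2 :: "nat \<Rightarrow> nat" where
  "g2 N = Max (card ` {A. A \<subseteq> {1..N} \<and> two_GP_free A})"

definition alpha2_bar :: real where
  "alpha2_bar = lim (\<lambda>N. real (g2 N) / real N)"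

end

theory Submission
  imports Defs "HOL-Analysis.Uniform_Limit"
begin

text \<open>
  Split the positive integers into the chains \<open>b, 2b, 4b, \<dots>\<close> with \<open>b\<close> odd. A set has no three-term
  2-geometric progression iff on each chain its exponents contain no three-term arithmetic
  progression. The density of a graded set is \<open>\<Sum>d\<^sub>i\<close>, where \<open>d\<^sub>i\<close> is the density of its part of
  valuation \<open>i\<close>, and averaging over \<open>b\<close> bounds this by the maximum of \<open>\<Sum>i\<in>E. 2\<^sup>-\<^sup>i\<^sup>-\<^sup>1\<close> over
  progression-free exponent sets \<open>E\<close>. Binary expansions are ordered lexicographically, so the
  greedy set is optimal. Without the density condition each chain may use a largest
  progression-free set for its own length; if \<open>r n\<close> is the largest size of such a subset of
  \<open>{0, \<dots>, n - 1}\<close>, this gives density \<open>\<Sum>i. (r (i + 1) - r i) 2\<^sup>-\<^sup>i\<^sup>-\<^sup>1\<close>, and \<open>r 9 \<ge> 5\<close> makes it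
  larger than \<open>d(T)\<close>.
\<close>

section \<open>Progression-free sets of exponents\<close>

definition AP_free :: "nat set \<Rightarrow> bool" where
  "AP_free E \<longleftrightarrow> (\<forall>x\<in>E. \<forall>y\<in>E. \<forall>z\<in>E. x + z = 2 * y \<longrightarrow> x = z)"

lemma AP_free_empty [simp]: "AP_free {}"
  by (simp add: AP_free_def)

lemma AP_free_subset: "AP_free E \<Longrightarrow> F \<subseteq> E \<Longrightarrow> AP_free F"
  unfolding AP_free_def by blast

definition chain_exponents :: "nat set \<Rightarrow> nat \<Rightarrow> nat set" where
  "chain_exponents S b = {i. 2 ^ i * b \<in> S}"

text \<open>Exponents \<open>x\<close>, \<open>x + m\<close>, \<open>x + 2 * m\<close> with
  \<open>m \<ge> 1\<close> on the chain of \<open>b\<close> form a geometric progression with first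
  term \<open>2 ^ x * b\<close> and ratio \<open>2 ^ m\<close>.\<close>

lemma two_GP_free_imp_AP_free:
  assumes "two_GP_free S" "b > 0"
  shows "AP_free (chain_exponents S b)"
proof -
  have no: False if "x < z" "x + z = 2 * y" "2 ^ x * b \<in> S" "2 ^ y * b \<in> S" "2 ^ z * b \<in> S" for x y z
  proof -
    define m where "m = y - x"
    have y: "y = x + m" and z: "z = x + 2 * m" and m: "m \<ge> 1"
      using that(1,2) unfolding m_def by linarith+
    have "2 ^ x * b * 2 ^ m \<in> S" "2 ^ x * b * (2 ^ m) ^ 2 \<in> S"
      using that(4,5) unfolding y z by (simp_all add: power_add power_mult mult_ac flip: power_mult)
    thus False
      using assms m that(3) unfolding two_GP_free_def
      by (metis mult_pos_pos zero_less_numeral zero_less_power)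
  qed
  show ?thesis
    unfolding AP_free_def chain_exponents_def
    by (clarsimp, metis no add.commute linorder_neqE_nat)
qed

lemma multiplicity_two_odd: "odd (b::nat) \<Longrightarrow> multiplicity 2 (2 ^ i * b) = i"
  by (intro multiplicity_eqI) (auto simp: mult.commute)

lemma odd_part_unique:
  assumes "2 ^ i * b = 2 ^ j * (c::nat)" "odd b" "odd c"
  shows "i = j \<and> b = c"
proof -
  have "i = j" using assms multiplicity_two_odd by metis
  thus ?thesis using assms by simp
qed

lemma odd_decomposition:
  assumes "(n::nat) > 0"
  obtains b where "odd b" "n = 2 ^ multiplicity 2 n * b"
  using multiplicity_decompose'[of n 2] assms by auto

text \<open>Multiplying by powers of 2 preserves the odd part, so all three terms of a progression
  lie on the chain of the odd part of the first.\<close>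

lemma two_GP_freeI:
  assumes "0 \<notin> S" "\<And>b. odd b \<Longrightarrow> AP_free (chain_exponents S b)"
  shows "two_GP_free S"
  unfolding two_GP_free_def
proof (safe)
  fix a k m :: nat
  assume a: "a > 0" "m \<ge> 1" "a \<in> S" "a * 2 ^ m \<in> S" "a * (2 ^ m) ^ 2 \<in> S"
  obtain b where b: "odd b" "a = 2 ^ multiplicity 2 a * b"
    using a(1) by (rule odd_decomposition)
  define i where "i = multiplicity 2 a"
  have ab: "a = 2 ^ i * b" using b(2) unfolding i_def .
  have "i \<in> chain_exponents S b" "i + m \<in> chain_exponents S b" "i + 2 * m \<in> chain_exponents S b"
    using a(3-5) unfolding ab chain_exponents_def
    by (simp_all add: power_add power_mult mult_ac flip: power_mult)
  moreover have "i + (i + 2 * m) = 2 * (i + m)" by simp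
  ultimately have "i = i + 2 * m"
    using assms(2)[OF b(1)] unfolding AP_free_def by blast
  thus False using a(2) by simp
qed

section \<open>The ternary digit set: free of progressions, and greedy\<close>

lemma A3_star_rec: "n \<in> A3_star \<longleftrightarrow> n div 3 \<in> A3_star \<and> n mod 3 \<noteq> 2"
proof -
  have "n \<in> A3_star \<longleftrightarrow> (\<forall>j. n div 3 ^ j mod 3 \<noteq> 2)"
    by (simp add: A3_star_def)
  also have "\<dots> \<longleftrightarrow> n mod 3 \<noteq> 2 \<and> (\<forall>j. n div 3 ^ Suc j mod 3 \<noteq> 2)"
    by (metis div_by_1 not0_implies_Suc power_0)
  finally show ?thesis
    by (auto simp: A3_star_def div_mult2_eq)
qed

lemma zero_in_A3_star: "0 \<in> A3_star"
  by (simp add: A3_star_def)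

text \<open>With digits 0 and 1 neither \<open>x + z\<close> nor \<open>2 * y\<close> produces a
  carry in base 3, so the equation holds digit by digit. The induction strips the last
  digit.\<close>

lemma AP_free_A3_star: "AP_free A3_star"
proof -
  have "x = z" if "x \<in> A3_star" "y \<in> A3_star" "z \<in> A3_star" "x + z = 2 * y" for x y z
    using that
  proof (induction y arbitrary: x z rule: less_induct)
    case (less y)
    have d: "x mod 3 \<noteq> 2" "y mod 3 \<noteq> 2" "z mod 3 \<noteq> 2"
      "x div 3 \<in> A3_star" "y div 3 \<in> A3_star" "z div 3 \<in> A3_star"
      using less.prems A3_star_rec[of x] A3_star_rec[of y] A3_star_rec[of z] by simp_all
    have eq: "x mod 3 = z mod 3" "x div 3 + z div 3 = 2 * (y div 3)"
    proof -
      have "u mod 3 = 0 \<or> u mod 3 = 1" if "u mod 3 \<noteq> 2" for u :: nat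
        using that mod_less_divisor[of 3 u] by linarith
      hence m: "x mod 3 = 0 \<or> x mod 3 = 1" "y mod 3 = 0 \<or> y mod 3 = 1" "z mod 3 = 0 \<or> z mod 3 = 1"
        using d(1-3) by auto
      have e: "3 * (x div 3) + x mod 3 + (3 * (z div 3) + z mod 3) = 2 * (3 * (y div 3) + y mod 3)"
        using less.prems(4) by simp
      \<comment> \<open>\<open>p + r\<close> and \<open>2 * q\<close> lie in {0, 1, 2} and agree
        modulo 3, so they are equal; then \<open>p + r\<close> is even, which forces
        \<open>p = r\<close>.\<close>
      have carry_free: "p = r \<and> a + c = 2 * b"
        if "p = 0 \<or> p = 1" "q = 0 \<or> q = 1" "r = 0 \<or> r = 1"
          "3 * a + p + (3 * c + r) = 2 * (3 * b + q)" for a b c p q r :: nat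
        using that by presburger
      show "x mod 3 = z mod 3" "x div 3 + z div 3 = 2 * (y div 3)"
        using carry_free[OF m e] by simp_all
    qed
    show ?case
    proof (cases "y = 0")
      case True
      thus ?thesis using less.prems by simp
    next
      case False
      hence "x div 3 = z div 3"
        using less.IH[of "y div 3"] d eq(2) by simp
      thus ?thesis using eq(1) by (metis mod_mult_div_eq)
    qed
  qed
  thus ?thesis unfolding AP_free_def by blast
qed

text \<open>Replacing each digit 2 of \<open>n\<close> by 1, respectively by 0, gives the two smaller terms of the progression.\<close>
lemma A3_star_greedy:
  "\<exists>x\<in>A3_star. \<exists>y\<in>A3_star. x + n = 2 * y \<and> x \<le> y \<and> (n \<notin> A3_star \<longrightarrow> x < y)"
proof (induction n rule: less_induct)
  case (less n)
  show ?case
  proof (cases "n = 0")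
    case True
    thus ?thesis using zero_in_A3_star by (intro bexI[of _ 0]) auto
  next
    case False
    then obtain x y where xy: "x \<in> A3_star" "y \<in> A3_star" "x + n div 3 = 2 * y" "x \<le> y"
      "n div 3 \<notin> A3_star \<longrightarrow> x < y"
      using less.IH[of "n div 3"] by auto
    have A: "3 * u + d \<in> A3_star" if "u \<in> A3_star" "d < 2" for u d
      using that by (subst A3_star_rec) auto
    have A0: "3 * u \<in> A3_star" if "u \<in> A3_star" for u
      using A[OF that, of 0] by simp
    have rec: "n \<in> A3_star \<longleftrightarrow> n div 3 \<in> A3_star \<and> n mod 3 \<noteq> 2" by (rule A3_star_rec)
    have div: "3 * (n div 3) + n mod 3 = n" by (rule mult_div_mod_eq)
    consider "n mod 3 = 0" | "n mod 3 = 1" | "n mod 3 = 2" by linarith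
    thus ?thesis
    proof cases
      case 1
      have "3 * x + n = 2 * (3 * y) \<and> 3 * x \<le> 3 * y \<and> (n \<notin> A3_star \<longrightarrow> 3 * x < 3 * y)"
        using xy(3-5) rec div 1 by auto
      thus ?thesis using A0 xy by blast
    next
      case 2
      have "(3 * x + 1) + n = 2 * (3 * y + 1) \<and> 3 * x + 1 \<le> 3 * y + 1 \<and>
          (n \<notin> A3_star \<longrightarrow> 3 * x + 1 < 3 * y + 1)"
        using xy(3-5) rec div 2 by auto
      thus ?thesis using A[of _ 1] xy by (metis one_less_numeral_iff semiring_norm(76))
    next
      case 3
      have "3 * x + n = 2 * (3 * y + 1) \<and> 3 * x \<le> 3 * y + 1 \<and>
          (n \<notin> A3_star \<longrightarrow> 3 * x < 3 * y + 1)"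
        using xy(3-5) rec div 3 by auto
      thus ?thesis using A[of _ 1] A0 xy by (metis one_less_numeral_iff semiring_norm(76))
    qed
  qed
qed

section \<open>Optimality of the greedy set\<close>

text \<open>The weight \<open>(1/2) ^ Suc i\<close> is the density of the integers of 2-adic
  valuation \<open>i\<close>.\<close>

definition dyadic_term :: "nat set \<Rightarrow> nat \<Rightarrow> real" where
  "dyadic_term E i = (if i \<in> E then (1/2) ^ Suc i else 0)"

definition dyadic_sum :: "nat set \<Rightarrow> real" where
  "dyadic_sum E = (\<Sum>i. dyadic_term E i)"

lemma summable_half_Suc: "summable (\<lambda>i. (1/2 :: real) ^ Suc i)"
  using power_half_series sums_summable by blast

lemma dyadic_term_bounds: "0 \<le> dyadic_term E i" "dyadic_term E i \<le> (1/2) ^ Suc i"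
  by (auto simp: dyadic_term_def)

lemma summable_dyadic_term: "summable (dyadic_term E)"
  by (rule summable_comparison_test'[OF summable_half_Suc, of 0])
     (auto simp: dyadic_term_def)

lemma sum_le_dyadic_sum: "sum (dyadic_term E) {..<n} \<le> dyadic_sum E"
  unfolding dyadic_sum_def
  by (intro sum_le_suminf summable_dyadic_term) (auto simp: dyadic_term_bounds)

text \<open>Even a full tail from \<open>n\<close> on has total weight only
  \<open>(1/2) ^ n\<close>, the weight of the single exponent \<open>n - 1\<close>. This makes the
  lexicographic comparison work.\<close>

lemma dyadic_sum_le: "dyadic_sum E \<le> sum (dyadic_term E) {..<n} + (1/2) ^ n"
proof -
  have "dyadic_sum E = (\<Sum>i. dyadic_term E (i + n)) + sum (dyadic_term E) {..<n}"
    unfolding dyadic_sum_def by (rule suminf_split_initial_segment[OF summable_dyadic_term])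
  also have "(\<Sum>i. dyadic_term E (i + n)) \<le> (\<Sum>i. (1/2) ^ n * (1/2) ^ Suc i)"
  proof (intro suminf_le)
    show "summable (\<lambda>i. dyadic_term E (i + n))"
      using summable_dyadic_term by (simp only: summable_iff_shift)
    show "summable (\<lambda>i. (1/2 :: real) ^ n * (1/2) ^ Suc i)"
      by (intro summable_mult summable_half_Suc)
    show "dyadic_term E (i + n) \<le> (1/2) ^ n * (1/2) ^ Suc i" for i
      using dyadic_term_bounds(2)[of E "i + n"] by (simp add: power_add mult_ac)
  qed
  also have "\<dots> = (1/2) ^ n"
    using suminf_mult[OF summable_half_Suc, of "(1/2) ^ n"] sums_unique[OF power_half_series] by simp
  finally show ?thesis by simp
qed

text \<open>A dyadic sum is maximal for the lexicographically largest indicator sequence, hence for the greedy set.\<close>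
lemma dyadic_sum_le_A3_star:
  assumes "AP_free E"
  shows "dyadic_sum E \<le> dyadic_sum A3_star"
proof (cases "E = A3_star")
  case False
  then obtain n0 where "(n0 \<in> E) \<noteq> (n0 \<in> A3_star)" by blast
  then obtain n where n: "(n \<in> E) \<noteq> (n \<in> A3_star)" "\<And>i. i < n \<Longrightarrow> i \<in> E \<longleftrightarrow> i \<in> A3_star"
    using exists_least_iff[of "\<lambda>i. (i \<in> E) \<noteq> (i \<in> A3_star)"] by auto
  have "n \<in> A3_star"
  proof (rule ccontr)
    \<comment> \<open>If the greedy set omits the first point \<open>n\<close> of disagreement, then
      \<open>n\<close> is in \<open>E\<close>, and the two smaller terms that block \<open>n\<close>
      are in \<open>E\<close> by agreement below \<open>n\<close>.\<close>
    assume *: "n \<notin> A3_star"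
    then obtain x y where xy: "x \<in> A3_star" "y \<in> A3_star" "x + n = 2 * y" "x < y"
      using A3_star_greedy[of n] by auto
    hence "x < n" "y < n" by auto
    hence "x \<in> E" "y \<in> E" "n \<in> E" using n xy * by auto
    thus False using assms xy(3) \<open>x < n\<close> unfolding AP_free_def by auto
  qed
  hence nE: "n \<notin> E" using n(1) by simp
  \<comment> \<open>\<open>E\<close> omits \<open>n\<close>; everything it may contain beyond
    \<open>n\<close> weighs at most as much as \<open>n\<close> itself, which the greedy set
    contains.\<close>
  have "dyadic_sum E \<le> sum (dyadic_term E) {..<Suc n} + (1/2) ^ Suc n"
    by (rule dyadic_sum_le)
  also have "\<dots> = sum (dyadic_term A3_star) {..<n} + (1/2) ^ Suc n"
    using nE n(2) by (simp add: dyadic_term_def)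
  also have "\<dots> = sum (dyadic_term A3_star) {..<Suc n}"
    using \<open>n \<in> A3_star\<close> by (simp add: dyadic_term_def)
  also have "\<dots> \<le> dyadic_sum A3_star" by (rule sum_le_dyadic_sum)
  finally show ?thesis .
qed simp

lemma dyadic_sum_A3_star_less: "dyadic_sum A3_star < 0.845398"
proof -
  have div9: "i div 9 = i div 3 div 3" for i :: nat
    using div_mult2_eq[of i 3 3] by simp
  have z: "dyadic_term A3_star i = 0" if "i mod 3 = 2 \<or> i div 3 mod 3 = 2 \<or> i div 9 mod 3 = 2" for i
  proof -
    have "i \<notin> A3_star"
      using that A3_star_rec[of i] A3_star_rec[of "i div 3"] A3_star_rec[of "i div 9"] div9[of i]
      by metis
    thus ?thesis by (simp add: dyadic_term_def)
  qed
  \<comment> \<open>Below 27 = 3^3 only three digits matter, leaving eight exponents. Their weights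
    add up to 0.84539794921875, and the tail bound is below 10^-8.\<close>
  have "dyadic_sum A3_star \<le> sum (dyadic_term A3_star) {..<27} + (1/2) ^ 27"
    by (rule dyadic_sum_le)
  also have "sum (dyadic_term A3_star) {..<27} =
      sum (dyadic_term A3_star) {0,1,3,4,9,10,12,13}"
  proof (rule sum.mono_neutral_right)
    have "i mod 3 = 2 \<or> i div 3 mod 3 = 2 \<or> i div 9 mod 3 = 2"
      if "i < 27" "i \<notin> {0,1,3,4,9,10,12,13}" for i :: nat
    proof (rule ccontr)
      assume *: "\<not> (i mod 3 = 2 \<or> i div 3 mod 3 = 2 \<or> i div 9 mod 3 = 2)"
      define a b c where "a = i div 9" and "b = i div 3 mod 3" and "c = i mod 3"
      have i: "i = 9 * a + 3 * b + c"
        unfolding a_def b_def c_def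
        using mult_div_mod_eq[of 3 i] mult_div_mod_eq[of 3 "i div 3"] div9[of i]
        by linarith
      have "a < 3"
        using that(1) unfolding a_def by linarith
      moreover have "b < 3" "c < 3" unfolding b_def c_def by simp_all
      moreover have "a \<noteq> 2" "b \<noteq> 2" "c \<noteq> 2"
        using * unfolding a_def b_def c_def by auto
      ultimately have "a = 0 \<or> a = 1" "b = 0 \<or> b = 1" "c = 0 \<or> c = 1" by linarith+
      thus False using that(2) unfolding i by auto
    qed
    thus "\<forall>i\<in>{..<27} - {0,1,3,4,9,10,12,13}. dyadic_term A3_star i = 0"
      using z by (metis DiffE lessThan_iff)
  qed auto
  also have "\<dots> \<le> (\<Sum>i\<in>{0,1,3,4,9,10,12,13}. (1/2) ^ Suc i)"
    by (intro sum_mono dyadic_term_bounds)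
  also have "\<dots> + (1/2) ^ 27 < (0.845398 :: real)"
    by (simp add: power_one_over)
  finally show ?thesis by simp
qed

section \<open>Densities of graded sets\<close>


definition odds :: "nat \<Rightarrow> nat set" where
  "odds M = {b. odd b \<and> b \<le> M}"

lemma finite_odds [simp]: "finite (odds M)"
  unfolding odds_def by (rule finite_subset[of _ "{..M}"]) auto

lemma card_odds: "card (odds M) = (M + 1) div 2"
proof (induction M)
  case 0
  have "odds 0 = {}" by (auto simp: odds_def elim: oddE)
  thus ?case by simp
next
  case (Suc M)
  have "odds (Suc M) = (if odd (Suc M) then insert (Suc M) (odds M) else odds M)"
    by (auto simp: odds_def le_Suc_eq)
  moreover have "Suc M \<notin> odds M" by (simp add: odds_def)
  ultimately show ?case using Suc.IH by (auto elim!: evenE oddE)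
qed

lemma mult_le_iff_le_div: "2 ^ i * b \<le> N \<longleftrightarrow> b \<le> N div 2 ^ i" for b N :: nat
  by (simp add: less_eq_div_iff_mult_less_eq mult.commute)

definition valuation_part :: "nat set \<Rightarrow> nat \<Rightarrow> nat set" where
  "valuation_part S i = {s \<in> S. multiplicity 2 s = i}"

text \<open>Dividing by \<open>2 ^ i\<close> reduces counting in one valuation class to counting odd
  parts.\<close>

lemma card_valuation_part:
  "card (valuation_part S i \<inter> {1..N}) = card {b \<in> odds (N div 2 ^ i). 2 ^ i * b \<in> S}"
proof -
  have "valuation_part S i \<inter> {1..N} = (\<lambda>b. 2 ^ i * b) ` {b \<in> odds (N div 2 ^ i). 2 ^ i * b \<in> S}"
  proof (intro set_eqI iffI)
    fix s assume s: "s \<in> valuation_part S i \<inter> {1..N}"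
    then obtain b where b: "odd b" "s = 2 ^ i * b"
      using odd_decomposition[of s] unfolding valuation_part_def by auto
    thus "s \<in> (\<lambda>b. 2 ^ i * b) ` {b \<in> odds (N div 2 ^ i). 2 ^ i * b \<in> S}"
      using s unfolding valuation_part_def odds_def by (auto simp: mult_le_iff_le_div)
  next
    fix s assume "s \<in> (\<lambda>b. 2 ^ i * b) ` {b \<in> odds (N div 2 ^ i). 2 ^ i * b \<in> S}"
    then obtain b where b: "s = 2 ^ i * b" "odd b" "b \<le> N div 2 ^ i" "s \<in> S"
      unfolding odds_def by auto
    thus "s \<in> valuation_part S i \<inter> {1..N}"
      unfolding valuation_part_def
      using mult_le_iff_le_div[of i b N] odd_pos[of b]
      by (auto simp: multiplicity_two_odd Suc_le_eq)
  qed
  moreover have "inj_on (\<lambda>b. 2 ^ i * b) B" for B :: "nat set"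
    by (auto simp: inj_on_def)
  ultimately show ?thesis by (simp add: card_image)
qed

lemma card_valuation_part_le: "card (valuation_part S i \<inter> {1..N}) \<le> N div 2 ^ i"
proof -
  have "card (valuation_part S i \<inter> {1..N}) \<le> card (odds (N div 2 ^ i))"
    unfolding card_valuation_part by (intro card_mono) auto
  also have "\<dots> \<le> N div 2 ^ i" unfolding card_odds by linarith
  finally show ?thesis .
qed

lemma card_eq_sum_valuation_part:
  "card (S \<inter> {1..N}) = (\<Sum>i<N. card (valuation_part S i \<inter> {1..N}))"
proof -
  \<comment> \<open>A valuation \<open>v\<close> of \<open>n\<close> satisfies
    \<open>v < 2 ^ v \<le> n\<close>, so finitely many classes cover {1..N}.\<close>
  have "multiplicity 2 n < N" if "n \<in> {1..N}" for n :: nat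
  proof -
    have "multiplicity 2 n < 2 ^ multiplicity 2 n" by (rule less_exp)
    also have "\<dots> \<le> n" using that by (intro dvd_imp_le multiplicity_dvd) auto
    finally show ?thesis using that by simp
  qed
  hence "S \<inter> {1..N} = (\<Union>i<N. valuation_part S i \<inter> {1..N})"
    unfolding valuation_part_def by auto
  moreover have "card (\<Union>i<N. valuation_part S i \<inter> {1..N}) =
      (\<Sum>i<N. card (valuation_part S i \<inter> {1..N}))"
    by (rule card_UN_disjoint) (auto simp: valuation_part_def)
  ultimately show ?thesis by simp
qed

text \<open>An infinite series removes the dependence of the index range on \<open>N\<close>, as
  needed for a termwise limit.\<close>

lemma density_seq_eq_suminf: "density_seq S N = (\<Sum>i. density_seq (valuation_part S i) N)"
proof -
  have z: "density_seq (valuation_part S i) N = 0" if "i \<notin> {..<N}" for i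
  proof -
    have "N < 2 ^ i" using that less_exp[of i] by (meson lessThan_iff not_less order_le_less_trans)
    thus ?thesis using card_valuation_part_le[of S i N] by (simp add: density_seq_def)
  qed
  have "(\<Sum>i. density_seq (valuation_part S i) N) = (\<Sum>i<N. density_seq (valuation_part S i) N)"
    using z by (intro suminf_finite) auto
  also have "\<dots> = density_seq S N"
    unfolding density_seq_def card_eq_sum_valuation_part[of S N] by (simp add: sum_divide_distrib)
  finally show ?thesis by simp
qed

lemma real_div_two_power_bounds:
  "real (N div 2 ^ i) \<le> real N / 2 ^ i" "real N / 2 ^ i < real (N div 2 ^ i) + 1"
proof -
  have "N div 2 ^ i * 2 ^ i \<le> N" "N < (N div 2 ^ i + 1) * 2 ^ i"
    using dividend_less_div_times[of "2 ^ i" N] by (simp_all add: add.commute)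
  hence "real (N div 2 ^ i * 2 ^ i) \<le> real N" "real N < real ((N div 2 ^ i + 1) * 2 ^ i)"
    by (simp_all only: of_nat_le_iff of_nat_less_iff)
  thus "real (N div 2 ^ i) \<le> real N / 2 ^ i" "real N / 2 ^ i < real (N div 2 ^ i) + 1"
    by (simp_all add: field_simps)
qed

lemma div_two_power_over_le: "real (N div 2 ^ i) / real N \<le> (1/2) ^ i"
proof (cases "N = 0")
  case False
  have "real (N div 2 ^ i) \<le> real N / 2 ^ i"
    by (rule real_div_two_power_bounds)
  thus ?thesis using False by (simp add: field_simps power_one_over)
qed simp

lemma density_seq_valuation_part_bounds:
  "0 \<le> density_seq (valuation_part S i) N" "density_seq (valuation_part S i) N \<le> (1/2) ^ i"
proof -
  show "0 \<le> density_seq (valuation_part S i) N" by (simp add: density_seq_def)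
  have "density_seq (valuation_part S i) N \<le> real (N div 2 ^ i) / real N"
    unfolding density_seq_def using card_valuation_part_le[of S i N] by (intro divide_right_mono) simp_all
  also have "\<dots> \<le> (1/2) ^ i" by (rule div_two_power_over_le)
  finally show "density_seq (valuation_part S i) N \<le> (1/2) ^ i" .
qed

text \<open>Dominated convergence for series with a geometric majorant; it serves both the graded
  densities and the limit of \<open>g2 N / N\<close>.\<close>

lemma tannery_geometric:
  fixes a :: "nat \<Rightarrow> nat \<Rightarrow> real"
  assumes "\<And>k. a k \<longlonglongrightarrow> b k" "\<And>k n. norm (a k n) \<le> (1/2) ^ k"
  shows "summable b" "(\<lambda>n. \<Sum>k. a k n) \<longlonglongrightarrow> suminf b"
proof -
  have "summable (\<lambda>n. norm (b n)) \<and> (\<lambda>n. \<Sum>k. a k n) \<longlonglongrightarrow> suminf b"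
    using tannerys_theorem[of a b sequentially "\<lambda>k. (1/2) ^ k"] assms
    by (simp add: always_eventually summable_geometric)
  thus "summable b" "(\<lambda>n. \<Sum>k. a k n) \<longlonglongrightarrow> suminf b"
    using summable_norm_cancel[of b] by auto
qed

text \<open>The part of valuation \<open>i\<close> has density at most \<open>(1/2) ^ i\<close>
  uniformly in \<open>N\<close>, so no mass escapes to large valuations in the limit.\<close>

lemma graded_density:
  assumes "\<And>i. density_seq (valuation_part S i) \<longlonglongrightarrow> d i"
  shows "summable d" "density_seq S \<longlonglongrightarrow> suminf d"
proof -
  have *: "norm (density_seq (valuation_part S k) n) \<le> (1/2) ^ k" for k n
    using density_seq_valuation_part_bounds[of S k n] by simp
  show "summable d" "density_seq S \<longlonglongrightarrow> suminf d"
    using tannery_geometric[of "\<lambda>i. density_seq (valuation_part S i)" d, OF assms *]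
    unfolding density_seq_eq_suminf[of S, abs_def] by simp_all
qed

lemma odds_ratio_tendsto:
  "(\<lambda>N. real (card (odds (N div 2 ^ i))) / real N) \<longlonglongrightarrow> (1/2) ^ Suc i"
proof (rule Lim_transform2)
  show "(\<lambda>N. (1/2 :: real) ^ Suc i) \<longlonglongrightarrow> (1/2) ^ Suc i" by simp
  have "norm ((1/2) ^ Suc i - real (card (odds (N div 2 ^ i))) / real N) \<le> 1 / real N"
    if "N \<ge> 1" for N
  proof -
    define M where "M = N div 2 ^ i"
    have 1: "real N / 2 ^ i - 1 \<le> real M" "real M \<le> real N / 2 ^ i"
      using real_div_two_power_bounds[of N i] unfolding M_def by simp_all
    have 2: "M \<le> 2 * card (odds M)" "2 * card (odds M) \<le> M + 1"
      unfolding card_odds by linarith+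
    \<comment> \<open>Rounding in \<open>N div 2 ^ i\<close> and in the count of odd numbers each
      costs at most 1.\<close>
    have "\<bar>2 * real (card (odds M)) - real N / 2 ^ i\<bar> \<le> 2"
      using 1 2 by linarith
    hence "\<bar>real N * (1/2) ^ Suc i - real (card (odds M))\<bar> \<le> 1"
      by (simp add: power_one_over field_simps abs_if split: if_splits)
    moreover have "(1/2) ^ Suc i - real (card (odds M)) / real N =
        (real N * (1/2) ^ Suc i - real (card (odds M))) / real N"
      using that by (simp add: diff_divide_distrib)
    ultimately show ?thesis
      unfolding M_def[symmetric] by (simp only: real_norm_def abs_divide abs_of_nat divide_right_mono of_nat_0_le_iff)
  qed
  hence "eventually (\<lambda>N. norm ((1/2) ^ Suc i - real (card (odds (N div 2 ^ i))) / real N) \<le> 1 / real N) sequentially"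
    by (intro eventually_sequentiallyI[of 1]) auto
  thus "(\<lambda>N. (1/2) ^ Suc i - real (card (odds (N div 2 ^ i))) / real N) \<longlonglongrightarrow> 0"
    by (rule Lim_null_comparison) (rule lim_1_over_n)
qed


text \<open>Exchanging the sums groups the weights by chain; the exponents on each chain are
  progression-free, so each chain contributes at most the greedy value.\<close>

lemma sum_odd_multiples_le:
  assumes "two_GP_free S"
  shows "(\<Sum>i<n. real (card {b \<in> odds M. 2 ^ i * b \<in> S}) * (1/2) ^ Suc i)
    \<le> real (card (odds M)) * dyadic_sum A3_star"
proof -
  have "(\<Sum>i<n. real (card {b \<in> odds M. 2 ^ i * b \<in> S}) * (1/2) ^ Suc i) =
      (\<Sum>i<n. \<Sum>b\<in>odds M. dyadic_term (chain_exponents S b) i)"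
    by (simp add: dyadic_term_def chain_exponents_def sum.If_cases Int_def)
  also have "\<dots> = (\<Sum>b\<in>odds M. \<Sum>i<n. dyadic_term (chain_exponents S b) i)"
    by (rule sum.swap)
  also have "\<dots> \<le> (\<Sum>b\<in>odds M. dyadic_sum A3_star)"
  proof (rule sum_mono)
    fix b assume "b \<in> odds M"
    hence "b > 0" by (auto simp: odds_def elim: oddE)
    hence "dyadic_sum (chain_exponents S b) \<le> dyadic_sum A3_star"
      using assms by (intro dyadic_sum_le_A3_star two_GP_free_imp_AP_free)
    thus "(\<Sum>i<n. dyadic_term (chain_exponents S b) i) \<le> dyadic_sum A3_star"
      using sum_le_dyadic_sum[of "chain_exponents S b" n] by linarith
  qed
  finally show ?thesis by simp
qed

text \<open>The density of part \<open>i\<close> is read off along the subsequence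
  \<open>2 ^ i * M\<close>. The odd parts then range over the same set \<open>odds M\<close> for
  every \<open>i\<close>, which permits averaging over chains.\<close>

lemma sum_valuation_densities_le:
  assumes "two_GP_free S" and d: "\<And>i. density_seq (valuation_part S i) \<longlonglongrightarrow> d i"
  shows "(\<Sum>i<n. d i) \<le> dyadic_sum A3_star"
proof (rule LIMSEQ_le)
  show "(\<lambda>M. \<Sum>i<n. density_seq (valuation_part S i) (2 ^ i * M)) \<longlonglongrightarrow> (\<Sum>i<n. d i)"
  proof (intro tendsto_sum)
    fix i
    have "strict_mono (\<lambda>M::nat. 2 ^ i * M)" by (auto simp: strict_mono_def)
    from LIMSEQ_subseq_LIMSEQ[OF d[of i] this]
    show "(\<lambda>M. density_seq (valuation_part S i) (2 ^ i * M)) \<longlonglongrightarrow> d i"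
      by (simp add: o_def)
  qed
  have "(\<lambda>M. real (card (odds M)) / real M) \<longlonglongrightarrow> 1/2"
    using odds_ratio_tendsto[of 0] by simp
  from tendsto_mult[OF this tendsto_const, of "2 * dyadic_sum A3_star"]
  show "(\<lambda>M. real (card (odds M)) / real M * (2 * dyadic_sum A3_star)) \<longlonglongrightarrow> dyadic_sum A3_star"
    by simp
  have "(\<Sum>i<n. density_seq (valuation_part S i) (2 ^ i * M))
      \<le> real (card (odds M)) / real M * (2 * dyadic_sum A3_star)" for M
  proof -
    \<comment> \<open>The factor 2 is the reciprocal of the density of the odd numbers. At
      \<open>M = 0\<close> both sides are 0, as division by zero yields 0.\<close>
    have "density_seq (valuation_part S i) (2 ^ i * M) =
        2 / real M * (real (card {b \<in> odds M. 2 ^ i * b \<in> S}) * (1/2) ^ Suc i)" for i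
      unfolding density_seq_def card_valuation_part by (simp add: power_one_over field_simps)
    hence "(\<Sum>i<n. density_seq (valuation_part S i) (2 ^ i * M)) =
        2 / real M * (\<Sum>i<n. real (card {b \<in> odds M. 2 ^ i * b \<in> S}) * (1/2) ^ Suc i)"
      by (simp only: sum_distrib_left)
    also have "\<dots> \<le> 2 / real M * (real (card (odds M)) * dyadic_sum A3_star)"
      by (intro mult_left_mono sum_odd_multiples_le assms) simp
    finally show ?thesis by (simp add: mult_ac)
  qed
  thus "\<exists>N. \<forall>M\<ge>N. (\<Sum>i<n. density_seq (valuation_part S i) (2 ^ i * M))
      \<le> real (card (odds M)) / real M * (2 * dyadic_sum A3_star)" by blast
qed

lemma two_graded_density_iff:
  "two_graded_density S \<longleftrightarrow> (\<forall>i. convergent (density_seq (valuation_part S i)))"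
  by (simp add: two_graded_density_def has_asymptotic_density_def valuation_part_def)

lemma two_GP_free_graded_density_le:
  assumes "two_GP_free S" "two_graded_density S"
  shows "has_asymptotic_density S" "asymptotic_density S \<le> dyadic_sum A3_star"
proof -
  define d where "d i = lim (density_seq (valuation_part S i))" for i
  have d: "density_seq (valuation_part S i) \<longlonglongrightarrow> d i" for i
    using assms(2) unfolding two_graded_density_iff d_def by (simp add: convergent_LIMSEQ_iff)
  note lim = graded_density[OF d]
  show "has_asymptotic_density S"
    unfolding has_asymptotic_density_def using lim(2) by (rule convergentI)
  have "asymptotic_density S = suminf d"
    unfolding asymptotic_density_def using lim(2) by (rule limI)
  also have "\<dots> \<le> dyadic_sum A3_star"
    by (intro suminf_le_const lim(1) sum_valuation_densities_le[OF assms(1) d])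
  finally show "asymptotic_density S \<le> dyadic_sum A3_star" .
qed

section \<open>The set T attains the bound\<close>

lemma mem_T_set_iff: "odd b \<Longrightarrow> 2 ^ i * b \<in> T_set \<longleftrightarrow> i \<in> A3_star"
  using odd_pos[of b] by (simp add: T_set_def multiplicity_two_odd)

lemma two_GP_free_T_set: "two_GP_free T_set"
proof (rule two_GP_freeI)
  show "AP_free (chain_exponents T_set b)" if "odd b" for b
    using AP_free_A3_star mem_T_set_iff[OF that] by (simp add: chain_exponents_def)
qed (simp add: T_set_def)

text \<open>\<open>T_set\<close> contains either all or none of the integers of a given
  valuation.\<close>

lemma valuation_part_T_set:
  "density_seq (valuation_part T_set i) \<longlonglongrightarrow> dyadic_term A3_star i"
proof (cases "i \<in> A3_star")
  case True
  hence "{b \<in> odds M. 2 ^ i * b \<in> T_set} = odds M" for M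
    by (auto simp: odds_def mem_T_set_iff)
  thus ?thesis
    using odds_ratio_tendsto[of i] True
    unfolding density_seq_def card_valuation_part dyadic_term_def by simp
next
  case False
  hence empty: "{b \<in> odds M. 2 ^ i * b \<in> T_set} = {}" for M
    by (auto simp: odds_def mem_T_set_iff)
  show ?thesis
    using False unfolding density_seq_def card_valuation_part dyadic_term_def empty by simp
qed

lemma two_graded_density_T_set: "two_graded_density T_set"
  unfolding two_graded_density_iff using valuation_part_T_set convergentI by blast

lemma asymptotic_density_T_set: "asymptotic_density T_set = dyadic_sum A3_star"
  unfolding asymptotic_density_def dyadic_sum_def
  using graded_density(2)[OF valuation_part_T_set] by (rule limI)

section \<open>The extremal function without grading\<close>

text \<open>The classical function \<open>r_3(n)\<close> of Roth's theorem, on the interval 0, ...,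
  \<open>n - 1\<close>.\<close>

definition max_AP_free :: "nat \<Rightarrow> nat" where
  "max_AP_free n = Max (card ` {E. E \<subseteq> {..<n} \<and> AP_free E})"

lemma card_le_max_AP_free: "E \<subseteq> {..<n} \<Longrightarrow> AP_free E \<Longrightarrow> card E \<le> max_AP_free n"
  unfolding max_AP_free_def by (intro Max_ge) auto

lemma max_AP_free_attained:
  obtains E where "E \<subseteq> {..<n}" "AP_free E" "card E = max_AP_free n"
proof -
  have "max_AP_free n \<in> card ` {E. E \<subseteq> {..<n} \<and> AP_free E}"
    unfolding max_AP_free_def by (intro Max_in) (auto intro: exI[of _ "{}"])
  thus ?thesis using that by auto
qed

lemma max_AP_free_0: "max_AP_free 0 = 0"
  by (rule max_AP_free_attained[of 0]) auto

lemma max_AP_free_mono: "m \<le> n \<Longrightarrow> max_AP_free m \<le> max_AP_free n"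
proof (rule max_AP_free_attained[of m])
  fix E assume E: "m \<le> n" "E \<subseteq> {..<m}" "AP_free E" "card E = max_AP_free m"
  hence "E \<subseteq> {..<n}" by auto
  thus ?thesis using E card_le_max_AP_free by metis
qed

lemma max_AP_free_Suc_le: "max_AP_free (Suc n) \<le> Suc (max_AP_free n)"
proof (rule max_AP_free_attained[of "Suc n"])
  fix E assume E: "E \<subseteq> {..<Suc n}" "AP_free E" "card E = max_AP_free (Suc n)"
  have "card (E - {n}) \<le> max_AP_free n"
    using E by (intro card_le_max_AP_free AP_free_subset[OF E(2)]) (auto simp: less_Suc_eq)
  thus ?thesis using E(3) card_Diff1_le[of E n] by (simp add: card_Diff_singleton_if split: if_splits)
qed

lemma max_AP_free_lower_bounds:
  "max_AP_free 1 \<ge> 1" "max_AP_free 2 \<ge> 2" "max_AP_free 4 \<ge> 3" "max_AP_free 5 \<ge> 4"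
  "max_AP_free 9 \<ge> 5"
proof -
  \<comment> \<open>The first four sets are initial parts of the greedy set. The last gives up 4 in
    order to admit both 7 and 8, whereas the fifth greedy element is 9.\<close>
  have "AP_free {0}" "AP_free {0, 1}" "AP_free {0, 1, 3}" "AP_free {0, 1, 3, 4}" "AP_free {0, 1, 3, 7, 8}"
    by (simp_all add: AP_free_def)
  thus "max_AP_free 1 \<ge> 1" "max_AP_free 2 \<ge> 2" "max_AP_free 4 \<ge> 3" "max_AP_free 5 \<ge> 4"
    "max_AP_free 9 \<ge> 5"
    using card_le_max_AP_free[of "{0}" 1] card_le_max_AP_free[of "{0, 1}" 2]
      card_le_max_AP_free[of "{0, 1, 3}" 4] card_le_max_AP_free[of "{0, 1, 3, 4}" 5]
      card_le_max_AP_free[of "{0, 1, 3, 7, 8}" 9] by simp_all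
qed

text \<open>For \<open>b > 0\<close>, the number of terms of the chain \<open>b\<close>,
  \<open>2 * b\<close>, \<open>4 * b\<close>, ... that are at most \<open>N\<close>.\<close>

definition chain_length :: "nat \<Rightarrow> nat \<Rightarrow> nat" where
  "chain_length N b = (LEAST i. N < 2 ^ i * b)"

lemma less_chain_length_iff:
  assumes "b > 0"
  shows "i < chain_length N b \<longleftrightarrow> 2 ^ i * b \<le> N"
proof -
  have "N < 2 ^ N * b" using assms less_exp[of N] by (metis less_le_trans mult.right_neutral mult_le_mono2 Suc_leI One_nat_def)
  hence *: "N < 2 ^ chain_length N b * b"
    unfolding chain_length_def by (rule LeastI)
  show ?thesis
  proof
    assume "i < chain_length N b"
    thus "2 ^ i * b \<le> N" unfolding chain_length_def using not_less_Least leI by blast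
  next
    assume i: "2 ^ i * b \<le> N"
    show "i < chain_length N b"
    proof (rule ccontr)
      assume "\<not> i < chain_length N b"
      hence "2 ^ chain_length N b * b \<le> 2 ^ i * b" by (simp add: power_increasing)
      thus False using i * by linarith
    qed
  qed
qed

lemma chain_length_le: "b > 0 \<Longrightarrow> chain_length N b \<le> N"
  using less_chain_length_iff[of b N N] less_exp[of N]
  by (metis leI le_trans mult.right_neutral mult_le_mono2 not_less Suc_leI One_nat_def)

lemma card_eq_sum_chain_exponents:
  assumes "A \<subseteq> {1..N}"
  shows "card A = (\<Sum>b\<in>odds N. card (chain_exponents A b))"
proof -
  have A: "(\<Union>b\<in>odds N. (\<lambda>i. 2 ^ i * b) ` chain_exponents A b) = A"
  proof (intro equalityI subsetI)
    fix a assume a: "a \<in> A"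
    hence "a > 0" using assms by auto
    then obtain b where b: "odd b" "a = 2 ^ multiplicity 2 a * b"
      by (rule odd_decomposition)
    have "b \<le> a" by (subst b(2)) simp
    hence "b \<in> odds N" using a assms b(1) by (auto simp: odds_def)
    moreover have "multiplicity 2 a \<in> chain_exponents A b"
      using a b(2) by (simp add: chain_exponents_def)
    ultimately show "a \<in> (\<Union>b\<in>odds N. (\<lambda>i. 2 ^ i * b) ` chain_exponents A b)"
      using b(2) by blast
  qed (auto simp: chain_exponents_def)
  have inj: "inj_on (\<lambda>i. 2 ^ i * b) E" if "b \<in> odds N" for b :: nat and E
    using that odd_part_unique[of _ b _ b] unfolding odds_def inj_on_def by blast
  have fin: "finite ((\<lambda>i. 2 ^ i * b) ` chain_exponents A b)" for b
    by (rule finite_subset[OF _ finite_subset[OF assms]]) (auto simp: chain_exponents_def)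
  have disj: "(\<lambda>i. 2 ^ i * b) ` chain_exponents A b \<inter> (\<lambda>i. 2 ^ i * c) ` chain_exponents A c = {}"
    if "b \<in> odds N" "c \<in> odds N" "b \<noteq> c" for b c
    using that odd_part_unique[of _ b _ c] unfolding odds_def by blast
  have "card A = (\<Sum>b\<in>odds N. card ((\<lambda>i. 2 ^ i * b) ` chain_exponents A b))"
    using card_UN_disjoint[of "odds N" "\<lambda>b. (\<lambda>i. 2 ^ i * b) ` chain_exponents A b"] fin disj
    unfolding A by simp
  thus ?thesis using inj by (simp add: card_image)
qed

text \<open>Chains do not interact: the upper bound holds chain by chain, and optimal choices on the
  separate chains combine into one admissible set.\<close>

lemma g2_eq: "g2 N = (\<Sum>b\<in>odds N. max_AP_free (chain_length N b))"
  unfolding g2_def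
proof (rule Max_eqI)
  show "finite (card ` {A. A \<subseteq> {1..N} \<and> two_GP_free A})"
    by (rule finite_imageI, rule finite_subset[of _ "Pow {1..N}"]) auto
next
  fix c assume "c \<in> card ` {A. A \<subseteq> {1..N} \<and> two_GP_free A}"
  then obtain A where A: "A \<subseteq> {1..N}" "two_GP_free A" "c = card A" by auto
  show "c \<le> (\<Sum>b\<in>odds N. max_AP_free (chain_length N b))"
    unfolding A(3) card_eq_sum_chain_exponents[OF A(1)]
  proof (rule sum_mono)
    fix b assume "b \<in> odds N"
    hence "b > 0" by (auto simp: odds_def elim: oddE)
    moreover from this have "chain_exponents A b \<subseteq> {..<chain_length N b}"
      using A(1) by (auto simp: chain_exponents_def less_chain_length_iff)
    ultimately show "card (chain_exponents A b) \<le> max_AP_free (chain_length N b)"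
      using A(2) by (intro card_le_max_AP_free two_GP_free_imp_AP_free)
  qed
next
  have "\<forall>n. \<exists>E. E \<subseteq> {..<n} \<and> AP_free E \<and> card E = max_AP_free n"
    using max_AP_free_attained by metis
  then obtain R where R: "\<And>n. R n \<subseteq> {..<n}" "\<And>n. AP_free (R n)" "\<And>n. card (R n) = max_AP_free n"
    by metis
  \<comment> \<open>Each chain carries a largest progression-free exponent set for its own length.
    This set varies with \<open>N\<close>, which a fixed graded set cannot imitate.\<close>
  define A where "A = {a. \<exists>b i. odd b \<and> i \<in> R (chain_length N b) \<and> a = 2 ^ i * b}"
  have chain: "chain_exponents A b = R (chain_length N b)" if "odd b" for b
    using that odd_part_unique unfolding A_def chain_exponents_def by blast
  have sub: "A \<subseteq> {1..N}"
  proof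
    fix a assume "a \<in> A"
    then obtain b i where a: "odd b" "i \<in> R (chain_length N b)" "a = 2 ^ i * b"
      unfolding A_def by blast
    have "b > 0" using a(1) by (rule odd_pos)
    moreover have "i < chain_length N b" using a(2) R(1) by blast
    ultimately show "a \<in> {1..N}" using less_chain_length_iff[of b i N] a(3) by (simp add: Suc_le_eq)
  qed
  have "two_GP_free A"
    using sub R(2) by (intro two_GP_freeI) (auto simp: chain)
  moreover have "card A = (\<Sum>b\<in>odds N. max_AP_free (chain_length N b))"
    unfolding card_eq_sum_chain_exponents[OF sub]
    by (intro sum.cong) (auto simp: odds_def chain R(3))
  ultimately show "(\<Sum>b\<in>odds N. max_AP_free (chain_length N b))
      \<in> card ` {A. A \<subseteq> {1..N} \<and> two_GP_free A}"
    using sub by (intro image_eqI[of _ _ A]) auto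
qed

section \<open>The limit of \<open>g2 N / N\<close>\<close>

definition AP_free_increment :: "nat \<Rightarrow> real" where
  "AP_free_increment i = real (max_AP_free (Suc i)) - real (max_AP_free i)"

lemma AP_free_increment_bounds: "0 \<le> AP_free_increment i" "AP_free_increment i \<le> 1"
  using max_AP_free_mono[of i "Suc i"] max_AP_free_Suc_le[of i]
  by (simp_all add: AP_free_increment_def)

lemma max_AP_free_eq_sum: "real (max_AP_free n) = (\<Sum>i<n. AP_free_increment i)"
  by (induction n) (simp_all add: AP_free_increment_def max_AP_free_0)

text \<open>Telescoping spreads the value of a chain over its exponents. Exchanging sums then
  counts, for each \<open>i\<close>, the chains longer than \<open>i\<close>, that is, the odd
  \<open>b \<le> N div 2 ^ i\<close>.\<close>

lemma g2_eq_sum: "real (g2 N) = (\<Sum>i<N. AP_free_increment i * real (card (odds (N div 2 ^ i))))"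
proof -
  have "real (g2 N) = (\<Sum>b\<in>odds N. \<Sum>i<chain_length N b. AP_free_increment i)"
    by (simp add: g2_eq max_AP_free_eq_sum)
  \<comment> \<open>Chain lengths are at most \<open>N\<close>, so padding with zeros makes the
    inner range independent of \<open>b\<close>.\<close>
  also have "\<dots> = (\<Sum>b\<in>odds N. \<Sum>i<N. if 2 ^ i * b \<le> N then AP_free_increment i else 0)"
  proof (rule sum.cong)
    fix b assume "b \<in> odds N"
    hence b: "b > 0" by (auto simp: odds_def elim: oddE)
    have "(\<Sum>i<N. if 2 ^ i * b \<le> N then AP_free_increment i else 0) =
        (\<Sum>i\<in>{i \<in> {..<N}. 2 ^ i * b \<le> N}. AP_free_increment i)"
      by (rule sum.inter_filter[symmetric]) simp
    also have "{i \<in> {..<N}. 2 ^ i * b \<le> N} = {..<chain_length N b}"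
      using less_chain_length_iff[OF b, of _ N] chain_length_le[OF b, of N] by fastforce
    finally show "(\<Sum>i<chain_length N b. AP_free_increment i) =
      (\<Sum>i<N. if 2 ^ i * b \<le> N then AP_free_increment i else 0)" by simp
  qed simp
  also have "\<dots> = (\<Sum>i<N. \<Sum>b\<in>odds N. if 2 ^ i * b \<le> N then AP_free_increment i else 0)"
    by (rule sum.swap)
  also have "\<dots> = (\<Sum>i<N. AP_free_increment i * real (card (odds (N div 2 ^ i))))"
  proof (rule sum.cong)
    fix i
    have "{b \<in> odds N. 2 ^ i * b \<le> N} = odds (N div 2 ^ i)"
      by (auto simp: odds_def mult_le_iff_le_div intro: le_trans[OF _ div_le_dividend])
    thus "(\<Sum>b\<in>odds N. if 2 ^ i * b \<le> N then AP_free_increment i else 0) =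
        AP_free_increment i * real (card (odds (N div 2 ^ i)))"
      using sum.inter_filter[of "odds N" "\<lambda>b. AP_free_increment i" "\<lambda>b. 2 ^ i * b \<le> N"] by (simp add: mult.commute)
  qed simp
  finally show ?thesis .
qed

lemma g2_ratio_tendsto:
  shows "summable (\<lambda>i. AP_free_increment i * (1/2) ^ Suc i)"
    and "(\<lambda>N. real (g2 N) / real N) \<longlonglongrightarrow> (\<Sum>i. AP_free_increment i * (1/2) ^ Suc i)"
proof -
  define a where "a i N = AP_free_increment i * (real (card (odds (N div 2 ^ i))) / real N)" for i N
  have lim: "a i \<longlonglongrightarrow> AP_free_increment i * (1/2) ^ Suc i" for i
    unfolding a_def by (intro tendsto_mult tendsto_const odds_ratio_tendsto)
  have bound: "norm (a i N) \<le> (1/2) ^ i" for i N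
  proof -
    have "card (odds (N div 2 ^ i)) \<le> N div 2 ^ i" unfolding card_odds by linarith
    hence "real (card (odds (N div 2 ^ i))) / real N \<le> real (N div 2 ^ i) / real N"
      by (intro divide_right_mono) simp_all
    also have "\<dots> \<le> (1/2) ^ i" by (rule div_two_power_over_le)
    finally have "a i N \<le> 1 * (1/2) ^ i"
      unfolding a_def by (intro mult_mono AP_free_increment_bounds) simp_all
    moreover have "a i N \<ge> 0" unfolding a_def by (simp add: AP_free_increment_bounds)
    ultimately show ?thesis by simp
  qed
  have "real (g2 N) / real N = (\<Sum>i. a i N)" for N
  proof -
    have "a i N = 0" if "i \<notin> {..<N}" for i
    proof -
      have "N < 2 ^ i" using that less_exp[of i] by (meson lessThan_iff not_less order_le_less_trans)
      thus ?thesis by (simp add: a_def card_odds)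
    qed
    hence "(\<Sum>i. a i N) = (\<Sum>i<N. a i N)" by (intro suminf_finite) auto
    thus ?thesis by (simp add: g2_eq_sum a_def sum_divide_distrib)
  qed
  thus "summable (\<lambda>i. AP_free_increment i * (1/2) ^ Suc i)"
    "(\<lambda>N. real (g2 N) / real N) \<longlonglongrightarrow> (\<Sum>i. AP_free_increment i * (1/2) ^ Suc i)"
    using tannery_geometric[OF lim bound] by simp_all
qed

text \<open>The greedy set has only four elements below 9, whereas five are possible; this already
  raises the sum above the density of \<open>T_set\<close>.\<close>
lemma alpha2_bar_greater: "0.845398 < alpha2_bar"
proof -
  \<comment> \<open>Lengths 3, 6, 7 and 8 inherit their lower bounds from shorter lengths.\<close>
  have mono: "max_AP_free 2 \<le> max_AP_free 3" "max_AP_free 5 \<le> max_AP_free 6"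
    "max_AP_free 6 \<le> max_AP_free 7" "max_AP_free 7 \<le> max_AP_free 8"
    by (simp_all add: max_AP_free_mono)
  \<comment> \<open>Summation by parts gives every \<open>max_AP_free n\<close> with
    \<open>1 \<le> n \<le> 9\<close> a positive coefficient, so lower bounds suffice. They yield 1/2
    + 1/4 + 1/16 + 1/32 + 1/512 = 0.845703125.\<close>
  have "0.845398 < (\<Sum>i<9. AP_free_increment i * (1/2) ^ Suc i)"
    using max_AP_free_lower_bounds mono
    by (simp add: AP_free_increment_def max_AP_free_0 eval_nat_numeral lessThan_Suc field_simps)
  also have "\<dots> \<le> (\<Sum>i. AP_free_increment i * (1/2) ^ Suc i)"
    by (intro sum_le_suminf g2_ratio_tendsto(1)) (simp_all add: AP_free_increment_bounds)
  also have "\<dots> = alpha2_bar"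
    unfolding alpha2_bar_def using limI[OF g2_ratio_tendsto(2)] by simp
  finally show ?thesis .
qed

theorem theorem6p1:
  shows "two_GP_free T_set \<and> two_graded_density T_set \<and> has_asymptotic_density T_set \<and>
    (\<forall>S. S \<subseteq> {1..} \<and> two_GP_free S \<and> two_graded_density S \<longrightarrow>
        has_asymptotic_density S \<and> asymptotic_density S \<le> asymptotic_density T_set) \<and>
    asymptotic_density T_set < 0.845398 \<and>
    convergent (\<lambda>N. real (g2 N) / real N) \<and> 0.845398 < alpha2_bar"
proof (intro conjI allI impI)
  show "convergent (\<lambda>N. real (g2 N) / real N)"
    using g2_ratio_tendsto(2) by (rule convergentI)
  show "asymptotic_density T_set < 0.845398"
    unfolding asymptotic_density_T_set by (rule dyadic_sum_A3_star_less)
  show "0.845398 < alpha2_bar" by (rule alpha2_bar_greater)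
  show "two_GP_free T_set" "two_graded_density T_set"
    by (rule two_GP_free_T_set two_graded_density_T_set)+
  thus "has_asymptotic_density T_set" by (rule two_GP_free_graded_density_le)
  fix S assume "S \<subseteq> {1..} \<and> two_GP_free S \<and> two_graded_density S"
  thus "has_asymptotic_density S" "asymptotic_density S \<le> asymptotic_density T_set"
    unfolding asymptotic_density_T_set using two_GP_free_graded_density_le by blast+
qed

end
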